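(* For $i=1,\dots,k$ fix a constant-coefficient linear recurrence whose characteristic polynomial has distinct nonzero roots $r^{(i)}_1,\dots,r^{(i)}_{d(i)}$ with multiplicities $e^{(i)}_1,\dots,e^{(i)}_{d(i)}$; let $D(i)=\sum_me^{(i)}_m$ and $\Delta(i)=\max_m(e^{(i)}_m-1)$. Let $b_1,\dots,b_k$ be positive integers and $c_1,\dots,c_k$ integers. Then there exist constants $\sigma_{i_1,\dots,i_k}$ ($0\le i_\nu\le D(\nu)-1$), depending only on the recurrences and on the $b_\nu,c_\nu$, such that for all sequences $F_1,\dots,F_k$ of the form $F_i(n)=\sum_{m=1}^{d(i)}\sum_{h=0}^{e^{(i)}_m-1}\lambda^{(i)}_{m,h}n^h(r^{(i)}_m)^n$ with $\lambda^{(i)}_{m,e^{(i)}_m-1}\ne0$ (i.e. for all initial conditions for which the given recurrence is minimal), setting $$S(n)=\sum_{i_1,\dots,i_k}\sigma_{i_1,\dots,i_k}F_1(b_1n+i_1)\cdots F_k(b_kn+i_k),$$ there is a polynomial $\Psi$ (which in general depends on the initial conditions of the $F_i$) with $$\sum_{j=0}^{n-1}F_1(b_1j+c_1)F_2(b_2j+c_2)\cdots F_k(b_kj+c_k)=\Psi(n)-S(n)\quad\text{for all }n\ge0.$$ If no product $(r^{(1)}_{m_1})^{b_1}\cdots(r^{(k)}_{m_k})^{b_k}$ ($1\le m_\ell\le d(\ell)$) equals $1$, then $\Psi$ is constant; otherwise $\Psi$ has degree at most $1+\sum_i\Delta(i)$.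
   Context: The formulas for $F_i$ define them on all integers. *)

theory Defs
  imports Complex_Main "HOL-Library.FuncSet" "HOL-Computational_Algebra.Polynomial"
begin

text \<open>
  A list \<open>a = [a\<^sub>0, \<dots>, a\<^sub>L]\<close> with \<open>L = length a - 1\<close> stands for the recurrence
  \<open>F (n + length a) = (\<Sum>j<length a. a ! j * F (n + j))\<close>.
\<close>

definition rec_char_poly :: "complex list \<Rightarrow> complex poly" where
  "rec_char_poly a = monom 1 (length a) - Poly a"

definition roots_with_multiplicities ::
  "complex poly \<Rightarrow> nat \<Rightarrow> (nat \<Rightarrow> complex) \<Rightarrow> (nat \<Rightarrow> nat) \<Rightarrow> bool" where
  "roots_with_multiplicities p d r e \<longleftrightarrow>
     inj_on r {1..d} \<and> r ` {1..d} = {z. poly p z = 0} \<and> (\<forall>m\<in>{1..d}. order (r m) p = e m)"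

text \<open>
  The nonvanishing of the top coefficients expresses that no recurrence of smaller order
  is satisfied by \<open>F\<close>.
\<close>

definition minimal_solution ::
  "nat \<Rightarrow> (nat \<Rightarrow> complex) \<Rightarrow> (nat \<Rightarrow> nat) \<Rightarrow> (int \<Rightarrow> complex) \<Rightarrow> bool" where
  "minimal_solution d r e F \<longleftrightarrow>
     (\<exists>lam :: nat \<Rightarrow> nat \<Rightarrow> complex.
        (\<forall>m\<in>{1..d}. lam m (e m - 1) \<noteq> 0) \<and>
        (\<forall>n. F n = (\<Sum>m=1..d. \<Sum>h<e m. lam m h * of_int n ^ h * r m powi n)))"

definition total_mult :: "nat \<Rightarrow> (nat \<Rightarrow> nat) \<Rightarrow> nat" where
  "total_mult d e = (\<Sum>m=1..d. e m)"

definition max_excess :: "nat \<Rightarrow> (nat \<Rightarrow> nat) \<Rightarrow> nat" where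
  "max_excess d e = Max ((\<lambda>m. e m - 1) ` {1..d})"

text \<open>
  Multi-indices \<open>(\<iota>\<^sub>1, \<dots>, \<iota>\<^sub>k)\<close> are extensional functions on \<open>{1..k}\<close>,
  so that each tuple is counted once.
\<close>

definition shifted_product_sum ::
  "nat \<Rightarrow> (nat \<Rightarrow> nat) \<Rightarrow> (nat \<Rightarrow> nat) \<Rightarrow> ((nat \<Rightarrow> nat) \<Rightarrow> complex) \<Rightarrow>
   (nat \<Rightarrow> int \<Rightarrow> complex) \<Rightarrow> nat \<Rightarrow> complex" where
  "shifted_product_sum k D b \<sigma> F n =
     (\<Sum>\<iota> \<in> (\<Pi>\<^sub>E \<nu>\<in>{1..k}. {..<D \<nu>}).
        \<sigma> \<iota> * (\<Prod>\<nu>=1..k. F \<nu> (int (b \<nu>) * int n + int (\<iota> \<nu>))))"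

end

theory Submission imports Defs begin

text \<open>
  Every \<open>F\<^sub>i\<close> is a combination of the functions \<open>n\<^sup>h r\<^sup>n\<close>, so by
  multilinearity it suffices to treat products of such functions, with \<open>\<sigma>\<close> independent of
  the choice of factors. The shift \<open>n \<mapsto> n + 1\<close> acts on these products by a triangular
  operator \<open>A\<close> whose diagonal entries are the numbers \<open>\<rho> = \<Prod> r\<^sup>b\<close>. A linear functional \<open>\<tau>\<close>
  with \<open>\<tau> w - \<tau> (A w) = \<phi> w\<close>, where \<open>\<phi>\<close> is evaluation at \<open>c\<close>, exists on the part where
  \<open>\<rho> \<noteq> 1\<close>, and there the sum telescopes to \<open>\<tau> w - \<tau> (A\<^sup>n w)\<close>. On the part where \<open>\<rho> = 1\<close> the
  summands are polynomials in \<open>j\<close>, and one takes \<open>\<tau> = 0\<close>. Finally, \<open>\<tau>\<close> is a combination of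
  the evaluations at \<open>0 \<le> i\<^sub>\<nu> < D(\<nu>)\<close>, because Hermite interpolation at the roots is solvable
  by polynomials of degree less than \<open>D(\<nu>)\<close>.
\<close>

section \<open>Power sums and sums of polynomials\<close>

text \<open>Telescoping the differences of \<open>j ^ Suc h\<close> and expanding them binomially
  gives a relation in which the sum of \<open>j ^ h\<close> has coefficient \<open>Suc h\<close> and
  all other power sums have a lower exponent.\<close>

lemma sum_powers_eq_poly:
  "\<exists>q :: 'a :: field_char_0 poly. degree q \<le> Suc h \<and>
     (\<forall>n. (\<Sum>j<n. of_nat j ^ h) = poly q (of_nat n))"
proof (induction h rule: less_induct)
  case (less h)
  then obtain Q :: "nat \<Rightarrow> 'a poly" where Q: "\<And>i. i < h \<Longrightarrow> degree (Q i) \<le> Suc i"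
    "\<And>i n. i < h \<Longrightarrow> (\<Sum>j<n. of_nat j ^ i) = poly (Q i) (of_nat n)"
    by metis
  \<comment> \<open>The telescoping relation solved for the power sum of exponent
    \<open>h\<close>.\<close>
  define q where "q = smult (inverse (of_nat (Suc h)))
    (monom 1 (Suc h) - (\<Sum>i<h. smult (of_nat (Suc h choose i)) (Q i)))"
  have "degree (\<Sum>i<h. smult (of_nat (Suc h choose i)) (Q i)) \<le> Suc h"
    using Q(1) by (intro degree_sum_le) (auto intro!: order.trans[OF degree_smult_le]
      intro: order.trans less_imp_le)
  then have "degree q \<le> Suc h"
    unfolding q_def
    by (intro order.trans[OF degree_smult_le] degree_diff_le) (auto simp: degree_monom_eq)
  moreover have "(\<Sum>j<n. of_nat j ^ h) = poly q (of_nat n)" for n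
  proof -
    \<comment> \<open>The boundary term at 0 vanishes because the exponent is positive.\<close>
    have "(of_nat n :: 'a) ^ Suc h = (\<Sum>j<n. of_nat (Suc j) ^ Suc h - of_nat j ^ Suc h)"
      by (subst sum_lessThan_telescope) simp
    also have "\<dots> = (\<Sum>j<n. \<Sum>i\<le>h. of_nat (Suc h choose i) * of_nat j ^ i)"
    proof (rule sum.cong[OF refl])
      fix j
      have "(of_nat (Suc j) :: 'a) ^ Suc h
          = (\<Sum>i\<le>Suc h. of_nat (Suc h choose i) * of_nat j ^ i)"
        using binomial_ring[of "of_nat j :: 'a" 1 "Suc h"] by (simp add: add.commute)
      then show "(of_nat (Suc j) :: 'a) ^ Suc h - of_nat j ^ Suc h
          = (\<Sum>i\<le>h. of_nat (Suc h choose i) * of_nat j ^ i)"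
        by simp
    qed
    also have "\<dots> = (\<Sum>i\<le>h. of_nat (Suc h choose i) * (\<Sum>j<n. of_nat j ^ i))"
      by (subst sum.swap) (simp add: sum_distrib_left)
    also have "\<dots> = (\<Sum>i<h. of_nat (Suc h choose i) * poly (Q i) (of_nat n))
        + of_nat (Suc h) * (\<Sum>j<n. of_nat j ^ h)"
      using Q(2) by (simp add: lessThan_Suc_atMost[symmetric] del: of_nat_Suc)
    finally have "of_nat (Suc h) * (\<Sum>j<n. (of_nat j :: 'a) ^ h)
        = of_nat n ^ Suc h - (\<Sum>i<h. of_nat (Suc h choose i) * poly (Q i) (of_nat n))"
      by (simp only: add_diff_cancel_left')
    moreover have "of_nat (Suc h) * poly q (of_nat n)
        = of_nat n ^ Suc h - (\<Sum>i<h. of_nat (Suc h choose i) * poly (Q i) (of_nat n))"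
      by (simp add: q_def poly_monom poly_sum del: of_nat_Suc)
    ultimately show ?thesis
      by (metis of_nat_neq_0 mult_left_cancel)
  qed
  ultimately show ?case by blast
qed

lemma sum_poly_eq_poly:
  fixes p :: "'a :: field_char_0 poly"
  shows "\<exists>q. degree q \<le> Suc (degree p) \<and> (\<forall>n. (\<Sum>j<n. poly p (of_nat j)) = poly q (of_nat n))"
proof -
  obtain Q :: "nat \<Rightarrow> 'a poly" where Q: "\<And>h. degree (Q h) \<le> Suc h"
    "\<And>h n. (\<Sum>j<n. of_nat j ^ h) = poly (Q h) (of_nat n)"
    using sum_powers_eq_poly by metis
  define q where "q = (\<Sum>h\<le>degree p. smult (coeff p h) (Q h))"
  have "degree q \<le> Suc (degree p)"
    unfolding q_def
    by (intro degree_sum_le) (auto intro!: order.trans[OF degree_smult_le] order.trans[OF Q(1)])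
  moreover have "(\<Sum>j<n. poly p (of_nat j)) = poly q (of_nat n)" for n
    unfolding q_def poly_altdef[of p] poly_sum
    by (subst sum.swap) (simp add: sum_distrib_left Q(2)[symmetric])
  ultimately show ?thesis by blast
qed

section \<open>The Euler operator and Hermite interpolation\<close>

text \<open>This is \<open>x d/dx\<close>. It is preferred to the plain derivative because it scales
  the coefficient of \<open>x ^ n\<close> by \<open>n\<close>, so that its iterates produce exactly
  the terms \<open>n ^ h * x ^ n\<close> of solutions of recurrences.\<close>

definition euler_op :: "'a :: idom poly \<Rightarrow> 'a poly" where
  "euler_op p = pCons 0 (pderiv p)"

lemma coeff_euler_op_funpow:
  fixes p :: "'a :: idom poly"
  shows "coeff ((euler_op ^^ h) p) n = of_nat n ^ h * coeff p n"
proof (induction h)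
  case (Suc h)
  then show ?case
    by (cases n) (simp_all add: euler_op_def coeff_pderiv)
qed simp

lemma poly_euler_op_funpow:
  fixes p :: "'a :: idom poly"
  assumes "\<And>n. n \<ge> D \<Longrightarrow> coeff p n = 0"
  shows "poly ((euler_op ^^ h) p) x = (\<Sum>n<D. coeff p n * (of_nat n ^ h * x ^ n))"
proof -
  have "(euler_op ^^ h) p = (\<Sum>n<D. monom (coeff p n * of_nat n ^ h) n)"
    by (rule poly_eqI) (use assms in \<open>auto simp: coeff_euler_op_funpow coeff_sum mult.commute\<close>)
  then show ?thesis
    by (simp add: poly_sum poly_monom mult.assoc)
qed

text \<open>The product rule, arranged so that one power of the linear factor is lost and the new
  cofactor takes the value \<open>of_nat (Suc s) * x * poly q x\<close> at \<open>x\<close>.\<close>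

lemma euler_op_linear_power_mult:
  fixes q :: "'a :: idom poly"
  shows "euler_op ([:-x, 1:] ^ Suc s * q)
    = [:-x, 1:] ^ s * ([:0, 1:] * (of_nat (Suc s) * q + [:-x, 1:] * pderiv q))"
proof -
  have "pderiv ([:-x, 1:] ^ Suc s) = of_nat (Suc s) * [:-x, 1:] ^ s"
    by (simp add: pderiv_power_Suc pderiv_pCons of_nat_poly del: of_nat_Suc power_Suc)
  moreover have "euler_op p = [:0, 1:] * pderiv p" for p :: "'a poly"
    by (simp add: euler_op_def)
  ultimately show ?thesis
    by (simp only: pderiv_mult power_Suc algebra_simps)
qed

text \<open>Each application lowers the order of vanishing at \<open>x\<close> by at most
  one.\<close>

lemma poly_euler_op_funpow_root_less:
  fixes q :: "'a :: idom poly"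
  shows "h < s \<Longrightarrow> poly ((euler_op ^^ h) ([:-x, 1:] ^ s * q)) x = 0"
proof (induction h arbitrary: s q)
  case (Suc h)
  then obtain s' where "s = Suc s'" "h < s'"
    using Suc_lessE by blast
  then show ?case
    using Suc.IH by (simp only: funpow_Suc_right o_apply euler_op_linear_power_mult)
qed simp

text \<open>Removing the linear factors one at a time contributes \<open>s * x\<close>, then
  \<open>(s - 1) * x\<close>, and so on. In characteristic 0 and at \<open>x\<close> different from
  0 the value is thus nonzero exactly when \<open>q\<close> does not vanish at
  \<open>x\<close>.\<close>

lemma poly_euler_op_funpow_root_eq:
  fixes q :: "'a :: field_char_0 poly"
  shows "poly ((euler_op ^^ s) ([:-x, 1:] ^ s * q)) x = fact s * x ^ s * poly q x"
proof (induction s arbitrary: q)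
  case (Suc s)
  show ?case
    by (simp only: funpow_Suc_right o_apply euler_op_linear_power_mult Suc.IH)
      (simp add: algebra_simps)
qed simp

text \<open>Induction on the number of conditions: interpolate with one condition removed, then
  correct by a multiple of a polynomial that satisfies the remaining conditions homogeneously.
  Bounding the coefficients instead of the degree covers the case of no conditions, where
  \<open>p\<close> must be 0.\<close>

lemma hermite_interpolation:
  fixes r :: "'m \<Rightarrow> 'a :: field_char_0"
  assumes "finite M" "inj_on r M" "\<And>m. m \<in> M \<Longrightarrow> r m \<noteq> 0"
  shows "\<exists>p. (\<forall>n\<ge>sum e M. coeff p n = 0) \<and>
    (\<forall>m\<in>M. \<forall>h<e m. poly ((euler_op ^^ h) p) (r m) = t m h)"
proof (induction "sum e M" arbitrary: e)
  case 0
  then show ?case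
    using assms(1) by (intro exI[of _ 0]) auto
next
  case (Suc D)
  then obtain u where u: "u \<in> M" "e u > 0"
    by (metis Zero_not_Suc gr0I sum.neutral)
  \<comment> \<open>The condition set aside is the one of highest order at the node
    \<open>u\<close>.\<close>
  define e' where "e' = e(u := e u - 1)"
  have D: "sum e' M = D"
    using Suc(2) assms(1) u by (simp add: e'_def sum.remove[of M u])
  obtain p where p: "\<And>n. n \<ge> D \<Longrightarrow> coeff p n = 0"
    "\<And>m h. m \<in> M \<Longrightarrow> h < e' m \<Longrightarrow> poly ((euler_op ^^ h) p) (r m) = t m h"
    using Suc(1)[of e'] D by auto
  \<comment> \<open>\<open>N\<close> vanishes at each node to the order \<open>e' m\<close>, so
    adding a multiple of it preserves every condition that \<open>p\<close> already meets.\<close>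
  define N where "N = (\<Prod>m\<in>M. [:- r m, 1:] ^ e' m)"
  have split: "N = [:- r m, 1:] ^ e' m * (\<Prod>l\<in>M - {m}. [:- r l, 1:] ^ e' l)" if "m \<in> M" for m
    unfolding N_def using assms(1) that by (rule prod.remove)
  have "degree N = D"
    unfolding N_def by (subst degree_prod_eq_sum_degree) (auto simp: degree_power_eq D)
  then have N0: "coeff N n = 0" if "n \<ge> Suc D" for n
    using that by (intro coeff_eq_0) auto
  define \<alpha> where "\<alpha> = poly ((euler_op ^^ e' u) N) (r u)"
  \<comment> \<open>The cofactor of the power at \<open>u\<close> is nonzero there because the nodes
    are distinct; the factor \<open>r u ^ e' u\<close> is nonzero because the nodes are.\<close>
  have "\<alpha> \<noteq> 0"
    unfolding \<alpha>_def split[OF u(1)] poly_euler_op_funpow_root_eq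
    using assms u by (auto simp: poly_prod inj_on_def)
  \<comment> \<open>The unique multiple of \<open>N\<close> that restores the condition set
    aside.\<close>
  define c where "c = (t u (e' u) - poly ((euler_op ^^ e' u) p) (r u)) / \<alpha>"
  have *: "poly ((euler_op ^^ h) (p + smult c N)) x
      = poly ((euler_op ^^ h) p) x + c * poly ((euler_op ^^ h) N) x" for h x
  proof -
    have "(euler_op ^^ h) (p + smult c N) = (euler_op ^^ h) p + smult c ((euler_op ^^ h) N)"
      by (rule poly_eqI) (simp add: coeff_euler_op_funpow algebra_simps)
    then show ?thesis by simp
  qed
  have "poly ((euler_op ^^ h) (p + smult c N)) (r m) = t m h" if "m \<in> M" "h < e m" for m h
  proof (cases "h < e' m")
    case True
    then have "poly ((euler_op ^^ h) N) (r m) = 0"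
      unfolding split[OF that(1)] by (rule poly_euler_op_funpow_root_less)
    then show ?thesis
      using p(2) that True by (simp add: *)
  next
    case False
    then have "m = u" "h = e' u"
      using that by (auto simp: e'_def split: if_splits)
    then show ?thesis
      unfolding * using \<open>\<alpha> \<noteq> 0\<close> by (simp add: c_def \<alpha>_def[symmetric])
  qed
  then show ?case
    using p(1) N0 unfolding Suc(2)[symmetric]
    by (intro exI[of _ "p + smult c N"]) auto
qed

section \<open>Exponential monomials, their translates and their values\<close>

definition exp_monom :: "('m \<Rightarrow> 'a :: field) \<Rightarrow> 'm \<times> nat \<Rightarrow> int \<Rightarrow> 'a" where
  "exp_monom r q x = of_int x ^ snd q * r (fst q) powi x"

text \<open>The matrix of translation by \<open>x\<close> in the basis of exponential monomials: one
  block per root, triangular in the exponent.\<close>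

definition shift_coeff :: "('m \<Rightarrow> 'a :: field) \<Rightarrow> int \<Rightarrow> 'm \<times> nat \<Rightarrow> 'm \<times> nat \<Rightarrow> 'a" where
  "shift_coeff r x q q' = (if fst q' = fst q \<and> snd q' \<le> snd q
     then of_nat (snd q choose snd q') * of_int x ^ (snd q - snd q') * r (fst q) powi x else 0)"

text \<open>Read the weights \<open>s n\<close> as the coefficients of a polynomial: the weighted
  sum is then an iterate of \<open>euler_op\<close> evaluated at a root, so interpolation supplies
  \<open>s\<close>. Hence every functional on the solutions is a combination of the values at the
  first \<open>sum e M\<close> integers.\<close>

lemma exp_monom_dual:
  fixes r :: "'m \<Rightarrow> 'a :: field_char_0"
  assumes "finite M" "inj_on r M" "\<And>m. m \<in> M \<Longrightarrow> r m \<noteq> 0"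
  shows "\<exists>s. \<forall>q \<in> Sigma M (\<lambda>m. {..<e m}).
    (\<Sum>n<sum e M. s n * exp_monom r q (int n)) = t q"
proof -
  obtain p where p: "\<And>n. n \<ge> sum e M \<Longrightarrow> coeff p n = 0"
    "\<And>m h. m \<in> M \<Longrightarrow> h < e m \<Longrightarrow> poly ((euler_op ^^ h) p) (r m) = t (m, h)"
    using hermite_interpolation[OF assms, where e = e and t = "\<lambda>m h. t (m, h)"] by auto
  show ?thesis
    using p(2) by (intro exI[of _ "coeff p"])
      (auto simp: poly_euler_op_funpow[where D = "sum e M", OF p(1)] exp_monom_def)
qed

lemma exp_monom_add:
  fixes r :: "'m \<Rightarrow> 'a :: field_char_0"
  assumes "finite M" and q: "q \<in> Sigma M (\<lambda>m. {..<e m})" and "r (fst q) \<noteq> 0"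
  shows "exp_monom r q (x + y)
    = (\<Sum>q' \<in> Sigma M (\<lambda>m. {..<e m}). shift_coeff r x q q' * exp_monom r q' y)"
proof -
  obtain m h where mh: "q = (m, h)" "m \<in> M" "h < e m"
    using q by auto
  \<comment> \<open>Only exponents up to \<open>h\<close> for the same root contribute, and all of
    them are available since \<open>h < e m\<close>.\<close>
  have "(\<Sum>q' \<in> Sigma M (\<lambda>m. {..<e m}). shift_coeff r x q q' * exp_monom r q' y)
      = (\<Sum>q' \<in> Pair m ` {..h}. shift_coeff r x q q' * exp_monom r q' y)"
    by (intro sum.mono_neutral_right) (use assms(1) mh in \<open>auto simp: shift_coeff_def\<close>)
  also have "\<dots> = (\<Sum>h'\<le>h. of_nat (h choose h') * of_int y ^ h' * of_int x ^ (h - h'))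
      * (r m powi x * r m powi y)"
    by (subst sum.reindex)
      (auto simp: inj_on_def shift_coeff_def exp_monom_def mh sum_distrib_left mult_ac intro!: sum.cong)
  also have "\<dots> = exp_monom r q (x + y)"
    using assms(3) by (simp add: exp_monom_def mh binomial_ring[symmetric] power_int_add add.commute)
  finally show ?thesis by simp
qed

section \<open>Triangular systems and tensor products of functionals\<close>

text \<open>Unknowns are added in order of increasing weight: the equations already solved do not
  involve a new unknown of maximal weight, so its own equation determines it.\<close>

lemma triangular_system_solvable:
  fixes L :: "'b \<Rightarrow> 'b \<Rightarrow> 'a :: field" and wt :: "'b \<Rightarrow> nat"
  assumes "finite K"
    and "\<And>x y. x \<in> K \<Longrightarrow> y \<in> K \<Longrightarrow> y \<noteq> x \<Longrightarrow> L x y \<noteq> 0 \<Longrightarrow> wt y < wt x"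
    and "\<And>x. x \<in> K \<Longrightarrow> L x x \<noteq> 0"
  shows "\<exists>\<tau>. \<forall>x\<in>K. (\<Sum>y\<in>K. L x y * \<tau> y) = t x"
  using assms
proof (induction K rule: finite_ranking_induct[where f = wt])
  case empty
  then show ?case by simp
next
  case (insert x S)
  obtain \<tau> where \<tau>: "\<And>z. z \<in> S \<Longrightarrow> (\<Sum>y\<in>S. L z y * \<tau> y) = t z"
    using insert.IH insert.prems by (metis insertCI)
  show ?case
  \<comment> \<open>The ranking induction does not exclude that \<open>x\<close> is already
    present.\<close>
  proof (cases "x \<in> S")
    case True
    then show ?thesis using \<tau> by (auto simp: insert_absorb)
  next
    case False
    define \<tau>' where "\<tau>' = \<tau>(x := (t x - (\<Sum>y\<in>S. L x y * \<tau> y)) / L x x)"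
    have *: "(\<Sum>y\<in>S. L z y * \<tau>' y) = (\<Sum>y\<in>S. L z y * \<tau> y)" for z
      using False by (intro sum.cong) (auto simp: \<tau>'_def)
    have "L z x = 0" if "z \<in> S" for z
      using insert.prems(1)[of z x] insert.hyps that False by (metis insertCI leD)
    then have "(\<Sum>y\<in>insert x S. L z y * \<tau>' y) = t z" if "z \<in> insert x S" for z
      using that False insert.hyps(1) insert.prems(2)[of x] \<tau> *
      by (auto simp: \<tau>'_def)
    then show ?thesis by blast
  qed
qed

text \<open>Products of dual bases of the single factors form a dual basis for the product
  functions; \<sigma> is the combination of these with the prescribed values \<tau> as
  weights.\<close>

lemma tensor_functional:
  fixes g :: "'i \<Rightarrow> 'q \<Rightarrow> 'n \<Rightarrow> 'a :: comm_ring_1"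
  assumes "finite I" "\<And>i. i \<in> I \<Longrightarrow> finite (Q i)" "\<And>i. i \<in> I \<Longrightarrow> finite (N i)"
    and dual: "\<And>i t. i \<in> I \<Longrightarrow> \<exists>s. \<forall>q\<in>Q i. (\<Sum>n\<in>N i. s n * g i q n) = t q"
  shows "\<exists>\<sigma>. \<forall>\<kappa> \<in> PiE I Q. (\<Sum>\<iota> \<in> PiE I N. \<sigma> \<iota> * (\<Prod>i\<in>I. g i (\<kappa> i) (\<iota> i))) = \<tau> \<kappa>"
proof -
  \<comment> \<open>For each factor, \<open>s q\<close> is the dual functional belonging to the
    index \<open>q\<close>.\<close>
  have "\<forall>i\<in>I. \<exists>s. \<forall>q. \<forall>q'\<in>Q i. (\<Sum>n\<in>N i. s q n * g i q' n) = of_bool (q' = q)"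
  proof
    fix i assume "i \<in> I"
    then have "\<forall>q. \<exists>s. \<forall>q'\<in>Q i. (\<Sum>n\<in>N i. s n * g i q' n) = of_bool (q' = q)"
      by (intro allI dual)
    then show "\<exists>s. \<forall>q. \<forall>q'\<in>Q i. (\<Sum>n\<in>N i. s q n * g i q' n) = of_bool (q' = q)"
      by (rule choice)
  qed
  from bchoice[OF this] obtain s where s: "\<And>i q q'. i \<in> I \<Longrightarrow> q' \<in> Q i \<Longrightarrow>
      (\<Sum>n\<in>N i. s i q n * g i q' n) = of_bool (q' = q)"
    by blast
  define \<sigma> where "\<sigma> = (\<lambda>\<iota>. \<Sum>\<kappa>' \<in> PiE I Q. \<tau> \<kappa>' * (\<Prod>i\<in>I. s i (\<kappa>' i) (\<iota> i)))"
  have "(\<Sum>\<iota> \<in> PiE I N. \<sigma> \<iota> * (\<Prod>i\<in>I. g i (\<kappa> i) (\<iota> i))) = \<tau> \<kappa>" if \<kappa>: "\<kappa> \<in> PiE I Q" for \<kappa>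
  proof -
    have "(\<Sum>\<iota> \<in> PiE I N. \<sigma> \<iota> * (\<Prod>i\<in>I. g i (\<kappa> i) (\<iota> i)))
        = (\<Sum>\<kappa>' \<in> PiE I Q. \<tau> \<kappa>' * (\<Sum>\<iota> \<in> PiE I N. \<Prod>i\<in>I. s i (\<kappa>' i) (\<iota> i) * g i (\<kappa> i) (\<iota> i)))"
      unfolding \<sigma>_def sum_distrib_right sum_distrib_left
      by (subst sum.swap) (simp add: prod.distrib mult.assoc)
    also have "\<dots> = (\<Sum>\<kappa>' \<in> PiE I Q. \<tau> \<kappa>' * (\<Prod>i\<in>I. of_bool (\<kappa> i = \<kappa>' i)))"
    proof (rule sum.cong[OF refl])
      fix \<kappa>'
      have "(\<Sum>\<iota> \<in> PiE I N. \<Prod>i\<in>I. s i (\<kappa>' i) (\<iota> i) * g i (\<kappa> i) (\<iota> i))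
          = (\<Prod>i\<in>I. \<Sum>n\<in>N i. s i (\<kappa>' i) n * g i (\<kappa> i) n)"
        using assms(1,3) by (simp add: prod_sum_PiE)
      also have "\<dots> = (\<Prod>i\<in>I. of_bool (\<kappa> i = \<kappa>' i))"
        by (intro prod.cong[OF refl]) (simp add: s PiE_mem[OF \<kappa>])
      finally show "\<tau> \<kappa>' * (\<Sum>\<iota> \<in> PiE I N. \<Prod>i\<in>I. s i (\<kappa>' i) (\<iota> i) * g i (\<kappa> i) (\<iota> i))
          = \<tau> \<kappa>' * (\<Prod>i\<in>I. of_bool (\<kappa> i = \<kappa>' i))"
        by simp
    qed
    also have "\<dots> = (\<Sum>\<kappa>' \<in> PiE I Q. if \<kappa>' = \<kappa> then \<tau> \<kappa>' else 0)"
    proof (rule sum.cong[OF refl])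
      fix \<kappa>' assume "\<kappa>' \<in> PiE I Q"
      then have "\<exists>i\<in>I. \<kappa> i \<noteq> \<kappa>' i" if "\<kappa>' \<noteq> \<kappa>"
        using that \<kappa> by (metis PiE_ext)
      then have "(\<Prod>i\<in>I. of_bool (\<kappa> i = \<kappa>' i)) = (0 :: 'a)" if "\<kappa>' \<noteq> \<kappa>"
        using that assms(1) by (intro prod_zero) auto
      then show "\<tau> \<kappa>' * (\<Prod>i\<in>I. of_bool (\<kappa> i = \<kappa>' i)) = (if \<kappa>' = \<kappa> then \<tau> \<kappa>' else 0)"
        by simp
    qed
    also have "\<dots> = \<tau> \<kappa>"
      using assms(1,2) \<kappa> by (simp add: sum.delta finite_PiE)
    finally show ?thesis .
  qed
  then show ?thesis by blast
qed

section \<open>Summation of products of exponential monomials\<close>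

text \<open>The case in which every factor is a single exponential monomial. That \<sigma> is chosen
  before \<kappa> is what allows the general case to follow by linearity.\<close>

lemma sum_prod_exp_monom:
  fixes r :: "'i \<Rightarrow> 'm \<Rightarrow> 'a :: field_char_0" and b :: "'i \<Rightarrow> nat" and c :: "'i \<Rightarrow> int"
  assumes "finite I" and M: "\<And>i. i \<in> I \<Longrightarrow> finite (M i)" "\<And>i. i \<in> I \<Longrightarrow> inj_on (r i) (M i)"
    and nz: "\<And>i m. i \<in> I \<Longrightarrow> m \<in> M i \<Longrightarrow> r i m \<noteq> 0"
  shows "\<exists>\<sigma>. \<forall>\<kappa> \<in> (\<Pi>\<^sub>E i\<in>I. Sigma (M i) (\<lambda>m. {..<e i m})). \<exists>\<Psi>.
    (\<forall>n. (\<Sum>j<n. \<Prod>i\<in>I. exp_monom (r i) (\<kappa> i) (int (b i) * int j + c i)) =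
       poly \<Psi> (of_nat n) - (\<Sum>\<iota> \<in> (\<Pi>\<^sub>E i\<in>I. {..<sum (e i) (M i)}).
         \<sigma> \<iota> * (\<Prod>i\<in>I. exp_monom (r i) (\<kappa> i) (int (b i) * int n + int (\<iota> i))))) \<and>
    degree \<Psi> \<le> (if (\<Prod>i\<in>I. r i (fst (\<kappa> i)) ^ b i) = 1 then Suc (\<Sum>i\<in>I. snd (\<kappa> i)) else 0)"
proof -
  define Q where "Q = (\<lambda>i. Sigma (M i) (\<lambda>m. {..<e i m}))"
  define K where "K = PiE I Q"
  define N where "N = (\<Pi>\<^sub>E i\<in>I. {..<sum (e i) (M i)})"
  \<comment> \<open>The factor by which the exponential part of the product grows when
    \<open>n\<close> increases by 1.\<close>
  define \<rho> where "\<rho> = (\<lambda>\<kappa> :: 'i \<Rightarrow> 'm \<times> nat. \<Prod>i\<in>I. r i (fst (\<kappa> i)) ^ b i)"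
  define P where "P = (\<lambda>\<kappa> y. \<Prod>i\<in>I. exp_monom (r i) (\<kappa> i) (y i))"
  \<comment> \<open>The matrix of the shift by \<open>n\<close> on product functions, a tensor
    product of the single shift matrices.\<close>
  define C where "C = (\<lambda>n \<kappa> \<kappa>'. \<Prod>i\<in>I. shift_coeff (r i) (int (b i) * int n) (\<kappa> i) (\<kappa>' i))"
  have fin_Q: "finite (Q i)" if "i \<in> I" for i
    using that M by (auto simp: Q_def)
  have fin_K: "finite K"
    unfolding K_def using assms(1) fin_Q by (intro finite_PiE) auto
  have K_nz: "r i (fst (\<kappa> i)) \<noteq> 0" if "\<kappa> \<in> K" "i \<in> I" for \<kappa> i
    using that nz by (fastforce simp: K_def Q_def PiE_def Pi_def)
  have expand: "P \<kappa> (\<lambda>i. int (b i) * int n + y i) = (\<Sum>\<kappa>'\<in>K. C n \<kappa> \<kappa>' * P \<kappa>' y)"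
    if \<kappa>: "\<kappa> \<in> K" for n \<kappa> y
  proof -
    have "P \<kappa> (\<lambda>i. int (b i) * int n + y i)
        = (\<Prod>i\<in>I. \<Sum>q'\<in>Q i. shift_coeff (r i) (int (b i) * int n) (\<kappa> i) q' * exp_monom (r i) q' (y i))"
      unfolding P_def Q_def
      by (intro prod.cong[OF refl] exp_monom_add) (use \<kappa> M K_nz in \<open>auto simp: K_def Q_def PiE_def Pi_def\<close>)
    then show ?thesis
      using assms(1) fin_Q by (simp add: prod_sum_PiE prod.distrib K_def C_def P_def)
  qed
  have C_nz: "fst (\<kappa>' i) = fst (\<kappa> i)" "snd (\<kappa>' i) \<le> snd (\<kappa> i)"
    if "C n \<kappa> \<kappa>' \<noteq> 0" "i \<in> I" for n \<kappa> \<kappa>' i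
  proof -
    have "shift_coeff (r i) (int (b i) * int n) (\<kappa> i) (\<kappa>' i) \<noteq> 0"
      using that assms(1) by (auto simp: C_def)
    then show "fst (\<kappa>' i) = fst (\<kappa> i)" "snd (\<kappa>' i) \<le> snd (\<kappa> i)"
      by (auto simp: shift_coeff_def split: if_splits)
  qed
  have C_\<rho>: "\<rho> \<kappa>' = \<rho> \<kappa>" if "C n \<kappa> \<kappa>' \<noteq> 0" for n \<kappa> \<kappa>'
    using C_nz(1)[OF that] by (simp add: \<rho>_def)
  have C_diag: "C 1 \<kappa> \<kappa> = \<rho> \<kappa>" for \<kappa>
    by (simp add: C_def \<rho>_def shift_coeff_def)
  \<comment> \<open>Rows with \<rho> different from 1 are those of identity minus shift, with
    diagonal entry \<open>1 - \<rho> \<kappa>\<close>. The other rows are those of the identity,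
    which will force \<tau> to be 0 there. No diagonal entry vanishes.\<close>
  define L where "L = (\<lambda>\<kappa> \<kappa>'. of_bool (\<kappa>' = \<kappa>) - (if \<rho> \<kappa> = 1 then 0 else C 1 \<kappa> \<kappa>'))"
  have "\<exists>\<tau>. \<forall>\<kappa>\<in>K. (\<Sum>\<kappa>'\<in>K. L \<kappa> \<kappa>' * \<tau> \<kappa>') = (if \<rho> \<kappa> = 1 then 0 else P \<kappa> c)"
  proof (rule triangular_system_solvable[where wt = "\<lambda>\<kappa>. \<Sum>i\<in>I. snd (\<kappa> i)", OF fin_K])
    fix \<kappa> \<kappa>' assume *: "\<kappa> \<in> K" "\<kappa>' \<in> K" "\<kappa>' \<noteq> \<kappa>" "L \<kappa> \<kappa>' \<noteq> 0"
    then have nz: "C 1 \<kappa> \<kappa>' \<noteq> 0"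
      by (auto simp: L_def split: if_splits)
    obtain i where i: "i \<in> I" "\<kappa>' i \<noteq> \<kappa> i"
      using *(1-3) unfolding K_def by (metis PiE_ext)
    \<comment> \<open>The roots agree, so the two indices can differ only in the exponent.\<close>
    then have "snd (\<kappa>' i) < snd (\<kappa> i)"
      using C_nz[OF nz i(1)] by (metis le_neq_implies_less prod_eqI)
    then show "(\<Sum>i\<in>I. snd (\<kappa>' i)) < (\<Sum>i\<in>I. snd (\<kappa> i))"
      using i(1) C_nz(2)[OF nz] assms(1) by (intro sum_strict_mono_ex1) auto
  qed (simp add: L_def C_diag del: One_nat_def)
  then obtain \<tau> where \<tau>: "\<And>\<kappa>. \<kappa> \<in> K \<Longrightarrow>
      (\<Sum>\<kappa>'\<in>K. L \<kappa> \<kappa>' * \<tau> \<kappa>') = (if \<rho> \<kappa> = 1 then 0 else P \<kappa> c)"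
    by blast
  have L_sum: "(\<Sum>\<kappa>'\<in>K. L \<kappa> \<kappa>' * \<tau> \<kappa>') = \<tau> \<kappa> - (if \<rho> \<kappa> = 1 then 0 else \<Sum>\<kappa>'\<in>K. C 1 \<kappa> \<kappa>' * \<tau> \<kappa>')"
    if "\<kappa> \<in> K" for \<kappa>
    using that fin_K
    by (simp add: L_def left_diff_distrib sum_subtractf of_bool_def if_distrib[of "\<lambda>x. x * _"] cong: if_cong)
  obtain \<sigma> where \<sigma>: "\<And>\<kappa>. \<kappa> \<in> K \<Longrightarrow> (\<Sum>\<iota>\<in>N. \<sigma> \<iota> * P \<kappa> (\<lambda>i. int (\<iota> i))) = \<tau> \<kappa>"
  proof -
    have "\<exists>\<sigma>. \<forall>\<kappa> \<in> PiE I Q. (\<Sum>\<iota>\<in>(\<Pi>\<^sub>E i\<in>I. {..<sum (e i) (M i)}).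
        \<sigma> \<iota> * (\<Prod>i\<in>I. exp_monom (r i) (\<kappa> i) (int (\<iota> i)))) = \<tau> \<kappa>"
      by (rule tensor_functional[where g = "\<lambda>i q n. exp_monom (r i) q (int n)"])
        (use assms(1) fin_Q exp_monom_dual[OF M nz] in \<open>auto simp: Q_def\<close>)
    then show ?thesis
      using that by (auto simp: K_def N_def P_def)
  qed
  \<comment> \<open>The sum \<open>S(n)\<close> for the product \<kappa>, that is, the functional
    \<tau> applied to the product shifted by \<open>n\<close>.\<close>
  define T where "T = (\<lambda>n \<kappa>. \<Sum>\<iota>\<in>N. \<sigma> \<iota> * P \<kappa> (\<lambda>i. int (b i) * int n + int (\<iota> i)))"
  have T_add: "T (n + n') \<kappa> = (\<Sum>\<kappa>'\<in>K. C n \<kappa> \<kappa>' * T n' \<kappa>')" if "\<kappa> \<in> K" for n n' \<kappa>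
  proof -
    have "T (n + n') \<kappa> = (\<Sum>\<iota>\<in>N. \<sigma> \<iota> * P \<kappa> (\<lambda>i. int (b i) * int n + (int (b i) * int n' + int (\<iota> i))))"
      by (simp add: T_def algebra_simps)
    also have "\<dots> = (\<Sum>\<iota>\<in>N. \<Sum>\<kappa>'\<in>K. C n \<kappa> \<kappa>' * (\<sigma> \<iota> * P \<kappa>' (\<lambda>i. int (b i) * int n' + int (\<iota> i))))"
      by (simp only: expand[OF that] sum_distrib_left mult.left_commute)
    finally show ?thesis
      by (subst (asm) sum.swap) (simp add: T_def sum_distrib_left)
  qed
  have T_0: "T 0 \<kappa> = \<tau> \<kappa>" if "\<kappa> \<in> K" for \<kappa>
    using \<sigma>[OF that] by (simp add: T_def)
  \<comment> \<open>Shifting preserves \<rho>, so only values of \<tau> at indices with \<rho> equal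
    to 1 enter, and these are 0.\<close>
  have T_unit: "T n \<kappa> = 0" if "\<kappa> \<in> K" "\<rho> \<kappa> = 1" for n \<kappa>
  proof -
    have "\<tau> \<kappa>' = 0" if "\<kappa>' \<in> K" "\<rho> \<kappa>' = 1" for \<kappa>'
      using \<tau>[OF that(1)] L_sum[OF that(1)] that(2) by simp
    then have "C n \<kappa> \<kappa>' * T 0 \<kappa>' = 0" if "\<kappa>' \<in> K" for \<kappa>'
      using C_\<rho>[of n \<kappa> \<kappa>'] T_0[OF that] that \<open>\<rho> \<kappa> = 1\<close> by auto
    then show ?thesis
      using T_add[of \<kappa> n 0] that(1) by (simp add: sum.neutral)
  qed
  have T_diff: "T n \<kappa> - T (Suc n) \<kappa> = P \<kappa> (\<lambda>i. int (b i) * int n + c i)"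
    if "\<kappa> \<in> K" "\<rho> \<kappa> \<noteq> 1" for n \<kappa>
  proof -
    \<comment> \<open>This reduces the claim to \<open>n = 0\<close>, where it is the linear system
      defining \<tau>; again only indices with the same \<rho> occur.\<close>
    have "T n \<kappa> - T (Suc n) \<kappa> = (\<Sum>\<kappa>'\<in>K. C n \<kappa> \<kappa>' * (T 0 \<kappa>' - T 1 \<kappa>'))"
      using T_add[OF that(1), of n 0] T_add[OF that(1), of n 1]
      by (simp add: right_diff_distrib sum_subtractf)
    also have "\<dots> = (\<Sum>\<kappa>'\<in>K. C n \<kappa> \<kappa>' * P \<kappa>' c)"
    proof (rule sum.cong[OF refl])
      fix \<kappa>' assume \<kappa>': "\<kappa>' \<in> K"
      have "T 0 \<kappa>' - T 1 \<kappa>' = P \<kappa>' c" if "\<rho> \<kappa>' \<noteq> 1"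
        using \<tau>[OF \<kappa>'] L_sum[OF \<kappa>'] T_add[OF \<kappa>', of 1 0] T_0 \<kappa>' that by simp
      then show "C n \<kappa> \<kappa>' * (T 0 \<kappa>' - T 1 \<kappa>') = C n \<kappa> \<kappa>' * P \<kappa>' c"
        using C_\<rho>[of n \<kappa> \<kappa>'] \<open>\<rho> \<kappa> \<noteq> 1\<close> by (cases "C n \<kappa> \<kappa>' = 0") auto
    qed
    finally show ?thesis
      using expand[OF that(1)] by simp
  qed
  have "\<exists>\<Psi>. (\<forall>n. (\<Sum>j<n. P \<kappa> (\<lambda>i. int (b i) * int j + c i)) = poly \<Psi> (of_nat n) - T n \<kappa>) \<and>
      degree \<Psi> \<le> (if \<rho> \<kappa> = 1 then Suc (\<Sum>i\<in>I. snd (\<kappa> i)) else 0)" if \<kappa>: "\<kappa> \<in> K" for \<kappa>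
  proof (cases "\<rho> \<kappa> = 1")
    case False
    have "(\<Sum>j<n. P \<kappa> (\<lambda>i. int (b i) * int j + c i)) = T 0 \<kappa> - T n \<kappa>" for n
      by (induction n) (simp_all add: T_diff[OF \<kappa> False, symmetric])
    with False show ?thesis
      by (intro exI[of _ "[:T 0 \<kappa>:]"]) auto
  next
    case True
    \<comment> \<open>The summand equals this polynomial at \<open>j\<close> times
      \<open>\<rho> \<kappa> ^ j\<close>, and the latter factor is 1 here.\<close>
    define p where "p = (\<Prod>i\<in>I. [:of_int (c i), of_nat (b i):] ^ snd (\<kappa> i)
      * [:r i (fst (\<kappa> i)) powi c i:])"
    have "degree p \<le> (\<Sum>i\<in>I. snd (\<kappa> i))"
      unfolding p_def
    proof (rule order.trans[OF degree_prod_sum_le[OF assms(1)]], rule sum_mono, unfold o_apply)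
      fix i
      have "degree ([:of_int (c i), of_nat (b i) :: 'a:] ^ snd (\<kappa> i)) \<le> 1 * snd (\<kappa> i)"
        by (rule order.trans[OF degree_power_le mult_right_mono]) auto
      then show "degree ([:of_int (c i), of_nat (b i):] ^ snd (\<kappa> i) * [:r i (fst (\<kappa> i)) powi c i:])
          \<le> snd (\<kappa> i)"
        by (intro order.trans[OF degree_mult_le]) simp
    qed
    moreover obtain q where q: "degree q \<le> Suc (degree p)"
      "\<And>n. (\<Sum>j<n. poly p (of_nat j)) = poly q (of_nat n)"
      using sum_poly_eq_poly by blast
    moreover have "P \<kappa> (\<lambda>i. int (b i) * int j + c i) = poly p (of_nat j)" for j
    proof -
      have "P \<kappa> (\<lambda>i. int (b i) * int j + c i) = poly p (of_nat j) * \<rho> \<kappa> ^ j"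
        unfolding P_def p_def \<rho>_def poly_prod prod_power_distrib prod.distrib[symmetric]
        using K_nz[OF \<kappa>]
        by (intro prod.cong)
          (simp_all add: exp_monom_def power_int_add power_int_mult algebra_simps flip: power_mult)
      then show ?thesis using True by simp
    qed
    ultimately show ?thesis
      using True T_unit[OF \<kappa> True] by (intro exI[of _ q]) auto
  qed
  then show ?thesis
    by (intro exI[of _ \<sigma>]) (auto simp: K_def Q_def N_def P_def T_def \<rho>_def)
qed


section \<open>The general case by multilinearity\<close>

theorem theorem24:
  fixes k :: nat
    and a :: "nat \<Rightarrow> complex list"
    and d :: "nat \<Rightarrow> nat"
    and r :: "nat \<Rightarrow> nat \<Rightarrow> complex"
    and e :: "nat \<Rightarrow> nat \<Rightarrow> nat"
    and b :: "nat \<Rightarrow> nat"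
    and c :: "nat \<Rightarrow> int"
  assumes "\<And>i. i \<in> {1..k} \<Longrightarrow> d i \<ge> 1"
    and "\<And>i. i \<in> {1..k} \<Longrightarrow> roots_with_multiplicities (rec_char_poly (a i)) (d i) (r i) (e i)"
    and "\<And>i m. i \<in> {1..k} \<Longrightarrow> m \<in> {1..d i} \<Longrightarrow> r i m \<noteq> 0"
    and "\<And>i. i \<in> {1..k} \<Longrightarrow> b i > 0"
  shows "\<exists>\<sigma> :: (nat \<Rightarrow> nat) \<Rightarrow> complex.
    \<forall>F :: nat \<Rightarrow> int \<Rightarrow> complex.
      (\<forall>i\<in>{1..k}. minimal_solution (d i) (r i) (e i) (F i)) \<longrightarrow>
      (\<exists>\<Psi> :: complex poly.
         (\<forall>n::nat. (\<Sum>j<n. \<Prod>i=1..k. F i (int (b i) * int j + c i)) =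
            poly \<Psi> (of_nat n)
              - shifted_product_sum k (\<lambda>i. total_mult (d i) (e i)) b \<sigma> F n) \<and>
         (if \<forall>\<mu> \<in> (\<Pi>\<^sub>E l\<in>{1..k}. {1..d l}). (\<Prod>l=1..k. r l (\<mu> l) ^ b l) \<noteq> 1
          then degree \<Psi> = 0
          else degree \<Psi> \<le> 1 + (\<Sum>i=1..k. max_excess (d i) (e i))))"
proof -
  define I where "I = {1..k}"
  define M where "M = (\<lambda>i. {1..d i})"
  define Q where "Q = (\<lambda>i. Sigma (M i) (\<lambda>m. {..<e i m}))"
  define N where "N = (\<Pi>\<^sub>E i\<in>I. {..<total_mult (d i) (e i)})"
  have fin: "finite I" "\<And>i. finite (Q i)"
    by (auto simp: I_def M_def Q_def)
  have "\<exists>\<sigma>. \<forall>\<kappa> \<in> PiE I Q. \<exists>\<Psi>.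
    (\<forall>n. (\<Sum>j<n. \<Prod>i\<in>I. exp_monom (r i) (\<kappa> i) (int (b i) * int j + c i)) =
       poly \<Psi> (of_nat n) - (\<Sum>\<iota>\<in>N. \<sigma> \<iota> *
         (\<Prod>i\<in>I. exp_monom (r i) (\<kappa> i) (int (b i) * int n + int (\<iota> i))))) \<and>
    degree \<Psi> \<le> (if (\<Prod>i\<in>I. r i (fst (\<kappa> i)) ^ b i) = 1 then Suc (\<Sum>i\<in>I. snd (\<kappa> i)) else 0)"
    unfolding Q_def N_def total_mult_def M_def
    by (rule sum_prod_exp_monom[where M = "\<lambda>i. {1..d i}"])
      (use assms(2,3) in \<open>auto simp: I_def roots_with_multiplicities_def\<close>)
  then obtain \<sigma> where "\<forall>\<kappa> \<in> PiE I Q. \<exists>\<Psi>.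
    (\<forall>n. (\<Sum>j<n. \<Prod>i\<in>I. exp_monom (r i) (\<kappa> i) (int (b i) * int j + c i)) =
       poly \<Psi> (of_nat n) - (\<Sum>\<iota>\<in>N. \<sigma> \<iota> *
         (\<Prod>i\<in>I. exp_monom (r i) (\<kappa> i) (int (b i) * int n + int (\<iota> i))))) \<and>
    degree \<Psi> \<le> (if (\<Prod>i\<in>I. r i (fst (\<kappa> i)) ^ b i) = 1 then Suc (\<Sum>i\<in>I. snd (\<kappa> i)) else 0)" ..
  from bchoice[OF this] obtain \<Psi> where \<Psi>: "\<And>\<kappa> n. \<kappa> \<in> PiE I Q \<Longrightarrow>
      (\<Sum>j<n. \<Prod>i\<in>I. exp_monom (r i) (\<kappa> i) (int (b i) * int j + c i)) =
        poly (\<Psi> \<kappa>) (of_nat n) - (\<Sum>\<iota>\<in>N. \<sigma> \<iota> *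
          (\<Prod>i\<in>I. exp_monom (r i) (\<kappa> i) (int (b i) * int n + int (\<iota> i))))"
    and deg: "\<And>\<kappa>. \<kappa> \<in> PiE I Q \<Longrightarrow> degree (\<Psi> \<kappa>)
      \<le> (if (\<Prod>i\<in>I. r i (fst (\<kappa> i)) ^ b i) = 1 then Suc (\<Sum>i\<in>I. snd (\<kappa> i)) else 0)"
    by blast
  show ?thesis
  proof (rule exI[of _ \<sigma>], intro allI impI)
    fix F :: "nat \<Rightarrow> int \<Rightarrow> complex"
    assume "\<forall>i\<in>{1..k}. minimal_solution (d i) (r i) (e i) (F i)"
    then have "\<forall>i\<in>I. \<exists>lam. \<forall>n. F i n = (\<Sum>m=1..d i. \<Sum>h<e i m. lam m h * of_int n ^ h * r i m powi n)"
      unfolding minimal_solution_def I_def by blast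
    from bchoice[OF this] obtain lam where lam: "\<forall>i\<in>I. \<forall>n.
        F i n = (\<Sum>m=1..d i. \<Sum>h<e i m. lam i m h * of_int n ^ h * r i m powi n)" ..
    have F: "F i n = (\<Sum>q\<in>Q i. lam i (fst q) (snd q) * exp_monom (r i) q n)" if "i \<in> I" for i n
    proof -
      have "F i n = (\<Sum>m\<in>M i. \<Sum>h<e i m. lam i m h * exp_monom (r i) (m, h) n)"
        using lam that unfolding M_def by (simp add: exp_monom_def mult.assoc)
      then show ?thesis
        by (simp add: Q_def M_def sum.Sigma case_prod_beta)
    qed
    \<comment> \<open>The coefficient of the product \<kappa> when the product of all
      \<open>F i\<close> is multiplied out. The initial conditions enter only here; \<sigma> was
      fixed before \<open>F\<close>.\<close>
    define \<Lambda> where "\<Lambda> = (\<lambda>\<kappa>. \<Prod>i\<in>I. lam i (fst (\<kappa> i)) (snd (\<kappa> i)))"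
    have prod_F: "(\<Prod>i\<in>I. F i (y i)) = (\<Sum>\<kappa>\<in>PiE I Q. \<Lambda> \<kappa> * (\<Prod>i\<in>I. exp_monom (r i) (\<kappa> i) (y i)))" for y
      by (simp add: F prod_sum_PiE[OF fin] prod.distrib \<Lambda>_def)
    define \<Phi> where "\<Phi> = (\<Sum>\<kappa>\<in>PiE I Q. smult (\<Lambda> \<kappa>) (\<Psi> \<kappa>))"
    have "(\<Sum>j<n. \<Prod>i\<in>I. F i (int (b i) * int j + c i)) = poly \<Phi> (of_nat n)
        - (\<Sum>\<iota>\<in>N. \<sigma> \<iota> * (\<Prod>i\<in>I. F i (int (b i) * int n + int (\<iota> i))))" for n
    proof -
      have "(\<Sum>j<n. \<Prod>i\<in>I. F i (int (b i) * int j + c i))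
          = (\<Sum>\<kappa>\<in>PiE I Q. \<Lambda> \<kappa> * (\<Sum>j<n. \<Prod>i\<in>I. exp_monom (r i) (\<kappa> i) (int (b i) * int j + c i)))"
        unfolding prod_F by (subst sum.swap) (simp add: sum_distrib_left)
      also have "\<dots> = poly \<Phi> (of_nat n) - (\<Sum>\<kappa>\<in>PiE I Q. \<Sum>\<iota>\<in>N. \<sigma> \<iota> * (\<Lambda> \<kappa> *
          (\<Prod>i\<in>I. exp_monom (r i) (\<kappa> i) (int (b i) * int n + int (\<iota> i)))))"
        by (simp add: \<Psi> \<Phi>_def poly_sum right_diff_distrib sum_subtractf sum_distrib_left
            mult.left_commute)
      also have "(\<Sum>\<kappa>\<in>PiE I Q. \<Sum>\<iota>\<in>N. \<sigma> \<iota> * (\<Lambda> \<kappa> *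
          (\<Prod>i\<in>I. exp_monom (r i) (\<kappa> i) (int (b i) * int n + int (\<iota> i)))))
          = (\<Sum>\<iota>\<in>N. \<sigma> \<iota> * (\<Prod>i\<in>I. F i (int (b i) * int n + int (\<iota> i))))"
        unfolding prod_F by (subst sum.swap) (simp add: sum_distrib_left)
      finally show ?thesis .
    qed
    moreover have "degree \<Phi> = 0"
      if const: "\<forall>\<mu> \<in> (\<Pi>\<^sub>E l\<in>I. {1..d l}). (\<Prod>l\<in>I. r l (\<mu> l) ^ b l) \<noteq> 1"
    proof -
      have "degree (\<Psi> \<kappa>) \<le> 0" if \<kappa>: "\<kappa> \<in> PiE I Q" for \<kappa>
      proof -
        \<comment> \<open>The choice of roots is restricted to \<open>I\<close> because
          \<open>const\<close> ranges over extensional functions.\<close>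
        have "(\<lambda>i\<in>I. fst (\<kappa> i)) \<in> (\<Pi>\<^sub>E l\<in>I. {1..d l})"
          using \<kappa> by (fastforce simp: Q_def M_def PiE_def Pi_def)
        then have "(\<Prod>i\<in>I. r i ((\<lambda>i\<in>I. fst (\<kappa> i)) i) ^ b i) \<noteq> 1"
          using const by blast
        then show ?thesis
          using deg[OF \<kappa>] by simp
      qed
      then have "degree \<Phi> \<le> 0"
        unfolding \<Phi>_def using fin
        by (intro degree_sum_le order.trans[OF degree_smult_le] finite_PiE) auto
      then show ?thesis by simp
    qed
    moreover have "degree \<Phi> \<le> 1 + (\<Sum>i\<in>I. max_excess (d i) (e i))"
    proof -
      have "degree (\<Psi> \<kappa>) \<le> 1 + (\<Sum>i\<in>I. max_excess (d i) (e i))" if \<kappa>: "\<kappa> \<in> PiE I Q" for \<kappa>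
      proof -
        have "snd (\<kappa> i) \<le> max_excess (d i) (e i)" if "i \<in> I" for i
        proof -
          have "fst (\<kappa> i) \<in> {1..d i}" "snd (\<kappa> i) < e i (fst (\<kappa> i))"
            using \<kappa> that by (fastforce simp: Q_def M_def PiE_def Pi_def)+
          then have "snd (\<kappa> i) \<le> e i (fst (\<kappa> i)) - 1" "e i (fst (\<kappa> i)) - 1 \<le> max_excess (d i) (e i)"
            unfolding max_excess_def by (auto intro!: Max_ge)
          then show ?thesis by linarith
        qed
        then have "(\<Sum>i\<in>I. snd (\<kappa> i)) \<le> (\<Sum>i\<in>I. max_excess (d i) (e i))"
          by (rule sum_mono)
        then show ?thesis
          using deg[OF \<kappa>] by (auto split: if_splits)
      qed
      then show ?thesis
        unfolding \<Phi>_def using fin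
        by (intro degree_sum_le order.trans[OF degree_smult_le] finite_PiE) auto
    qed
    ultimately show "\<exists>\<Psi> :: complex poly.
         (\<forall>n::nat. (\<Sum>j<n. \<Prod>i=1..k. F i (int (b i) * int j + c i)) =
            poly \<Psi> (of_nat n)
              - shifted_product_sum k (\<lambda>i. total_mult (d i) (e i)) b \<sigma> F n) \<and>
         (if \<forall>\<mu> \<in> (\<Pi>\<^sub>E l\<in>{1..k}. {1..d l}). (\<Prod>l=1..k. r l (\<mu> l) ^ b l) \<noteq> 1
          then degree \<Psi> = 0
          else degree \<Psi> \<le> 1 + (\<Sum>i=1..k. max_excess (d i) (e i)))"
      unfolding shifted_product_sum_def I_def N_def by (intro exI[of _ \<Phi>]) auto
  qed
qed

end
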